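(* Let $\mathcal{S}=\langle\mathcal{L},\vdash_\gamma\rangle$ and $\mathcal{T}=\langle\mathcal{L}',\vdash_\delta\rangle$ be two deductive systems with domains $S$ and $T$, and let $\gamma$ and $\delta$ be the structural closure operators associated to $\vdash_\gamma$ and $\vdash_\delta$ respectively, both assumed different from the identity map. Then $\mathcal{S}$ is non-structurally interpretable in $\mathcal{T}$ if and only if there exists an injective homomorphism of sup-lattices $$f:\wp(\mathbf{S})_\gamma\to\wp(\mathbf{T})_\delta.$$
   Context: A propositional language is $\mathcal{L}=\langle L,\nu\rangle$ with $L$ a set of connectives and $\nu:L\to\mathbb{N}_0$ the arity; formulas are built over a denumerable set of variables; substitutions are maps from variables to formulas, extended to formulas. A sequent of type $(m,n)$ over $\mathcal{L}$ is a pair of sequences of $\mathcal{L}$-formulas of lengths $m$ and $n$ (not both zero). A deductive system $\mathcal{S}=\langle\mathcal{L},\vdash_\gamma\rangle$ has as domain a set $S$ of sequents over $\mathcal{L}$ closed under type (containing all sequents of each type it contains; formulas are $(0,1)$-sequents and equations $(1,1)$-sequents), with a finitary, substitution-invariant consequence relation $\vdash_\gamma$ on $\wp(S)$: $\Psi\subseteq\Phi$ implies $\Phi\vdash\Psi$; $\vdash$ is transitive; $\Phi\vdash\bigcup_{\Phi\vdash\Psi}\Psi$; if $\Phi\vdash\Psi$ with $\Psi$ finite then $\Phi_0\vdash\Psi$ for some finite $\Phi_0\subseteq\Phi$; $\Phi\vdash\Psi$ implies $\sigma[\Phi]\vdash\sigma[\Psi]$ for each substitution $\sigma$. The associated closure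 operator is $\gamma(\Phi)=\bigcup\{\Psi\mid\Phi\vdash_\gamma\Psi\}$. $\wp(\mathbf{S})_\gamma$ is the sup-lattice $\{\gamma(\Phi)\mid\Phi\subseteq S\}$ ordered by inclusion, with join $\gamma(\bigcup_i\Phi_i)$; similarly $\wp(\mathbf{T})_\delta$. Sup-lattice homomorphisms preserve arbitrary joins. $\mathcal{S}$ is non-structurally interpretable in $\mathcal{T}$ if there is a residuated (i.e. arbitrary-union-preserving) map $\iota:\wp(S)\to\wp(T)$ such that, for all $\Phi,\Psi\in\wp(S)$, $\Phi\vdash_\gamma\Psi$ if and only if $\iota(\Phi)\vdash_\delta\iota(\Psi)$. *)

theory Defs
  imports "HOL-Algebra.Complete_Lattice"
begin

record 'c language =
  conns :: "'c set"
  arity :: "'c \<Rightarrow> nat"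

text \<open>
  The denumerable set of variables is \<^typ>\<open>nat\<close>. The datatype contains raw terms over all
  symbols of type \<^typ>\<open>'c\<close>; the formulas over a language are the arity-respecting terms
  built from its connectives, as singled out by \<open>formulas\<close>.
\<close>

datatype 'c form = Var nat | App 'c "'c form list"

inductive_set formulas :: "'c language \<Rightarrow> 'c form set" for L :: "'c language" where
  Var: "Var x \<in> formulas L"
| App: "\<lbrakk>c \<in> conns L; length \<phi>s = arity L c; \<And>\<phi>. \<phi> \<in> set \<phi>s \<Longrightarrow> \<phi> \<in> formulas L\<rbrakk>
    \<Longrightarrow> App c \<phi>s \<in> formulas L"

primrec subst :: "(nat \<Rightarrow> 'c form) \<Rightarrow> 'c form \<Rightarrow> 'c form" where
  "subst \<sigma> (Var x) = \<sigma> x"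
| "subst \<sigma> (App c \<phi>s) = App c (map (subst \<sigma>) \<phi>s)"

definition substitutions :: "'c language \<Rightarrow> (nat \<Rightarrow> 'c form) set" where
  "substitutions L = {\<sigma>. \<forall>x. \<sigma> x \<in> formulas L}"

text \<open>
  A formula \<open>\<phi>\<close> is identified with the sequent \<open>([], [\<phi>])\<close> and an equation
  \<open>\<phi> = \<psi>\<close> with \<open>([\<phi>], [\<psi>])\<close>.
\<close>

type_synonym 'c seqt = "'c form list \<times> 'c form list"

definition seqt_type :: "'c seqt \<Rightarrow> nat \<times> nat" where
  "seqt_type s = (length (fst s), length (snd s))"

definition seqts :: "'c language \<Rightarrow> 'c seqt set" where
  "seqts L = {s. seqt_type s \<noteq> (0, 0) \<and> set (fst s) \<union> set (snd s) \<subseteq> formulas L}"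

definition seqt_subst :: "(nat \<Rightarrow> 'c form) \<Rightarrow> 'c seqt \<Rightarrow> 'c seqt" where
  "seqt_subst \<sigma> s = (map (subst \<sigma>) (fst s), map (subst \<sigma>) (snd s))"

definition closed_under_type :: "'c language \<Rightarrow> 'c seqt set \<Rightarrow> bool" where
  "closed_under_type L S \<longleftrightarrow> S \<subseteq> seqts L \<and>
     (\<forall>s\<in>S. \<forall>t\<in>seqts L. seqt_type t = seqt_type s \<longrightarrow> t \<in> S)"

record 'c dsystem =
  lang :: "'c language"
  sdom :: "'c seqt set"
  entails :: "'c seqt set \<Rightarrow> 'c seqt set \<Rightarrow> bool" (infix "\<turnstile>\<index>" 50)

locale deductive_system =
  fixes D :: "'c dsystem" (structure)
  assumes sdom_closed: "closed_under_type (lang D) (sdom D)"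
    and entails_dom: "\<Phi> \<turnstile> \<Psi> \<Longrightarrow> \<Phi> \<subseteq> sdom D \<and> \<Psi> \<subseteq> sdom D"
    and entails_subset: "\<lbrakk>\<Phi> \<subseteq> sdom D; \<Psi> \<subseteq> \<Phi>\<rbrakk> \<Longrightarrow> \<Phi> \<turnstile> \<Psi>"
    and entails_trans: "\<lbrakk>\<Phi> \<turnstile> \<Psi>; \<Psi> \<turnstile> \<Xi>\<rbrakk> \<Longrightarrow> \<Phi> \<turnstile> \<Xi>"
    and entails_Union: "\<Phi> \<subseteq> sdom D \<Longrightarrow> \<Phi> \<turnstile> \<Union>{\<Psi>. \<Phi> \<turnstile> \<Psi>}"
    and finitary: "\<lbrakk>\<Phi> \<turnstile> \<Psi>; finite \<Psi>\<rbrakk> \<Longrightarrow> \<exists>\<Phi>\<^sub>0 \<subseteq> \<Phi>. finite \<Phi>\<^sub>0 \<and> \<Phi>\<^sub>0 \<turnstile> \<Psi>"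
    and subst_invariant: "\<lbrakk>\<Phi> \<turnstile> \<Psi>; \<sigma> \<in> substitutions (lang D)\<rbrakk>
      \<Longrightarrow> seqt_subst \<sigma> ` \<Phi> \<turnstile> seqt_subst \<sigma> ` \<Psi>"

definition cl :: "'c dsystem \<Rightarrow> 'c seqt set \<Rightarrow> 'c seqt set" where
  "cl D \<Phi> = \<Union>{\<Psi>. \<Phi> \<turnstile>\<^bsub>D\<^esub> \<Psi>}"

definition theory_lattice :: "'c dsystem \<Rightarrow> 'c seqt set gorder" where
  "theory_lattice D = \<lparr>carrier = cl D ` Pow (sdom D), eq = (=), le = (\<subseteq>)\<rparr>"

text \<open>
  The library predicate \<open>sup_pres\<close> requires preservation of all joins (including the empty
  one) but does not require the map to send the one carrier into the other.
\<close>

definition sup_lattice_hom :: "('a, 'x) gorder_scheme \<Rightarrow> ('b, 'y) gorder_scheme \<Rightarrow> ('a \<Rightarrow> 'b) \<Rightarrow> bool"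
  where "sup_lattice_hom X Y f \<longleftrightarrow> f \<in> carrier X \<rightarrow> carrier Y \<and> sup_pres X Y f"

definition residuated :: "'a set \<Rightarrow> 'b set \<Rightarrow> ('a set \<Rightarrow> 'b set) \<Rightarrow> bool" where
  "residuated S T \<iota> \<longleftrightarrow> \<iota> \<in> Pow S \<rightarrow> Pow T \<and> (\<forall>\<A> \<subseteq> Pow S. \<iota> (\<Union>\<A>) = \<Union>(\<iota> ` \<A>))"

definition nonstructurally_interpretable :: "'c dsystem \<Rightarrow> 'd dsystem \<Rightarrow> bool" where
  "nonstructurally_interpretable D E \<longleftrightarrow>
     (\<exists>\<iota>. residuated (sdom D) (sdom E) \<iota> \<and>
       (\<forall>\<Phi> \<subseteq> sdom D. \<forall>\<Psi> \<subseteq> sdom D. \<Phi> \<turnstile>\<^bsub>D\<^esub> \<Psi> \<longleftrightarrow> \<iota> \<Phi> \<turnstile>\<^bsub>E\<^esub> \<iota> \<Psi>))"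

context deductive_system
begin

lemma cl_subset_sdom: "cl D \<Phi> \<subseteq> sdom D"
  using entails_dom by (auto simp: cl_def)

lemma entails_iff: "\<Phi> \<turnstile> \<Psi> \<longleftrightarrow> \<Phi> \<subseteq> sdom D \<and> \<Psi> \<subseteq> cl D \<Phi>"
proof
  assume "\<Phi> \<turnstile> \<Psi>"
  then show "\<Phi> \<subseteq> sdom D \<and> \<Psi> \<subseteq> cl D \<Phi>"
    using entails_dom by (auto simp: cl_def)
next
  assume h: "\<Phi> \<subseteq> sdom D \<and> \<Psi> \<subseteq> cl D \<Phi>"
  then have "\<Phi> \<turnstile> cl D \<Phi>"
    using entails_Union[of \<Phi>] by (simp add: cl_def)
  moreover have "cl D \<Phi> \<turnstile> \<Psi>"
    using h by (intro entails_subset cl_subset_sdom) simp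
  ultimately show "\<Phi> \<turnstile> \<Psi>"
    by (rule entails_trans)
qed

lemma cl_extensive: "\<Phi> \<subseteq> sdom D \<Longrightarrow> \<Phi> \<subseteq> cl D \<Phi>"
  using entails_subset[of \<Phi> \<Phi>] by (simp add: entails_iff)

lemma cl_least: "\<lbrakk>\<Phi> \<subseteq> cl D \<Psi>; \<Psi> \<subseteq> sdom D\<rbrakk> \<Longrightarrow> cl D \<Phi> \<subseteq> cl D \<Psi>"
proof -
  assume "\<Phi> \<subseteq> cl D \<Psi>" "\<Psi> \<subseteq> sdom D"
  then have 1: "\<Psi> \<turnstile> \<Phi>"
    by (simp add: entails_iff)
  then have "\<Phi> \<turnstile> cl D \<Phi>"
    using entails_dom[OF 1] by (simp add: entails_iff)
  from entails_trans[OF 1 this] show "cl D \<Phi> \<subseteq> cl D \<Psi>"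
    by (simp add: entails_iff)
qed

lemma cl_mono: "\<lbrakk>\<Phi> \<subseteq> \<Psi>; \<Psi> \<subseteq> sdom D\<rbrakk> \<Longrightarrow> cl D \<Phi> \<subseteq> cl D \<Psi>"
  by (rule cl_least) (auto dest: cl_extensive)

lemma cl_idem: "\<Phi> \<subseteq> sdom D \<Longrightarrow> cl D (cl D \<Phi>) = cl D \<Phi>"
  by (simp add: antisym cl_extensive cl_least cl_subset_sdom)

lemma partial_order_theory_lattice: "partial_order (theory_lattice D)"
  by standard (auto simp: theory_lattice_def)

lemma least_theory_lattice:
  assumes "A \<subseteq> carrier (theory_lattice D)"
  shows "least (theory_lattice D) (cl D (\<Union>A)) (Upper (theory_lattice D) A)"
proof -
  have A: "\<Union>A \<subseteq> sdom D"
    using assms cl_subset_sdom by (auto simp: theory_lattice_def)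
  have "cl D (\<Union>A) \<subseteq> b" if "b \<in> carrier (theory_lattice D)" "\<forall>a\<in>A. a \<subseteq> b" for b
  proof -
    obtain \<Psi> where "\<Psi> \<subseteq> sdom D" "b = cl D \<Psi>"
      using \<open>b \<in> _\<close> by (auto simp: theory_lattice_def)
    then show ?thesis
      using that(2) cl_least Union_least by metis
  qed
  moreover have "a \<subseteq> cl D (\<Union>A)" if "a \<in> A" for a
    by (rule order_trans[OF Union_upper[OF that] cl_extensive[OF A]])
  moreover have "cl D (\<Union>A) \<in> carrier (theory_lattice D)"
    using A by (simp add: theory_lattice_def)
  ultimately have *: "\<forall>b\<in>carrier (theory_lattice D). (\<forall>a\<in>A. a \<subseteq> b) \<longrightarrow> cl D (\<Union>A) \<subseteq> b"
    "\<forall>a\<in>A. a \<subseteq> cl D (\<Union>A)" "cl D (\<Union>A) \<in> carrier (theory_lattice D)"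
    by simp_all
  have le: "le (theory_lattice D) = (\<subseteq>)"
    by (simp add: theory_lattice_def)
  have up: "Upper (theory_lattice D) A = {b \<in> carrier (theory_lattice D). \<forall>a\<in>A. a \<subseteq> b}"
    using assms unfolding Upper_def le by blast
  show ?thesis
    unfolding least_def le up using * by simp
qed

lemma greatest_theory_lattice:
  assumes "A \<subseteq> carrier (theory_lattice D)"
  shows "\<exists>i. greatest (theory_lattice D) i (Lower (theory_lattice D) A)"
proof -
  let ?L = "theory_lattice D"
  let ?i = "cl D (\<Union>(Lower ?L A))"
  have le: "le ?L = (\<subseteq>)"
    by (simp add: theory_lattice_def)
  have low: "Lower ?L A = {b \<in> carrier ?L. \<forall>a\<in>A. b \<subseteq> a}"
    using assms unfolding Lower_def le by blast
  have l: "least ?L ?i (Upper ?L (Lower ?L A))"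
    by (rule least_theory_lattice[OF Lower_closed])
  have i: "?i \<in> carrier ?L"
    using l unfolding least_def Upper_def by blast
  have up: "b \<subseteq> ?i" if "b \<in> Lower ?L A" for b
    using l that unfolding least_def Upper_def le low by blast
  have "?i \<subseteq> a" if "a \<in> A" for a
  proof -
    have "a \<in> Upper ?L (Lower ?L A)"
      using that assms unfolding Upper_def le low by blast
    then show ?thesis
      using l unfolding least_def le by blast
  qed
  then have "?i \<in> Lower ?L A"
    using i unfolding low by blast
  then have "greatest ?L ?i (Lower ?L A)"
    using up Lower_closed[of ?L A] unfolding greatest_def le by blast
  then show ?thesis ..
qed

lemma complete_lattice_theory_lattice: "complete_lattice (theory_lattice D)"
proof -
  interpret partial_order "theory_lattice D"
    by (rule partial_order_theory_lattice)
  show ?thesis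
    by standard (rule exI, rule least_theory_lattice, assumption, rule greatest_theory_lattice)
qed

lemma sup_theory_lattice:
  assumes "A \<subseteq> carrier (theory_lattice D)"
  shows "\<Squnion>\<^bsub>theory_lattice D\<^esub>A = cl D (\<Union>A)"
proof -
  interpret complete_lattice "theory_lattice D"
    by (rule complete_lattice_theory_lattice)
  show ?thesis
    by (rule supI[OF _ assms]) (rule least_unique[OF _ least_theory_lattice[OF assms]])
qed

end

end

theory Submission
  imports Defs
begin

text \<open>
  An interpretation \<open>\<iota>\<close> induces the map \<open>X \<mapsto> cl T (\<iota> X)\<close> on theories. Conversely, since every
  theory is the join of the theories generated by its elements, a sup-lattice embedding \<open>f\<close> is
  recovered from \<open>\<iota> \<Phi> = (\<Union>x\<in>\<Phi>. f (cl S {x}))\<close>, which preserves unions by construction and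
  satisfies \<open>cl T (\<iota> \<Phi>) = f (cl S \<Phi>)\<close>.
\<close>

lemma carrier_theory_lattice: "carrier (theory_lattice D) = cl D ` Pow (sdom D)"
  by (simp add: theory_lattice_def)

context deductive_system
begin

text \<open>Turns entailment into reverse inclusion of theories, so that an interpretation can be
  read as an order embedding. Since \<open>cl D \<Psi>\<close> is the least theory containing
  \<open>\<Psi>\<close>, it lies below \<open>cl D \<Phi>\<close> as soon as \<open>\<Psi>\<close>
  does.\<close>

lemma entails_iff_cl_subset:
  assumes "\<Phi> \<subseteq> sdom D" "\<Psi> \<subseteq> sdom D"
  shows "\<Phi> \<turnstile> \<Psi> \<longleftrightarrow> cl D \<Psi> \<subseteq> cl D \<Phi>"
  using assms cl_least[of \<Psi> \<Phi>] cl_extensive[of \<Psi>] by (auto simp: entails_iff)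

lemma cl_UN_cl:
  assumes "\<And>i. i \<in> I \<Longrightarrow> F i \<subseteq> sdom D"
  shows "cl D (\<Union>i\<in>I. cl D (F i)) = cl D (\<Union>i\<in>I. F i)"
proof
  have sub: "(\<Union>i\<in>I. F i) \<subseteq> sdom D"
    using assms by blast
  then have "cl D (F i) \<subseteq> cl D (\<Union>i\<in>I. F i)" if "i \<in> I" for i
    using that by (intro cl_mono) auto
  then show "cl D (\<Union>i\<in>I. cl D (F i)) \<subseteq> cl D (\<Union>i\<in>I. F i)"
    using sub by (intro cl_least) auto
  show "cl D (\<Union>i\<in>I. F i) \<subseteq> cl D (\<Union>i\<in>I. cl D (F i))"
    using assms by (intro cl_mono UN_mono cl_extensive UN_least cl_subset_sdom) auto
qed

lemma cl_theory: "X \<in> carrier (theory_lattice D) \<Longrightarrow> cl D X = X"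
  by (auto simp: carrier_theory_lattice cl_idem)

lemma theory_subset_sdom: "X \<in> carrier (theory_lattice D) \<Longrightarrow> X \<subseteq> sdom D"
  using cl_subset_sdom by (auto simp: carrier_theory_lattice)

end

lemma sup_lattice_hom_theory_lattice_iff:
  assumes "deductive_system S" "deductive_system T"
  shows "sup_lattice_hom (theory_lattice S) (theory_lattice T) f \<longleftrightarrow>
    f \<in> carrier (theory_lattice S) \<rightarrow> carrier (theory_lattice T) \<and>
    (\<forall>\<A> \<subseteq> carrier (theory_lattice S). f (cl S (\<Union>\<A>)) = cl T (\<Union>(f ` \<A>)))"
proof -
  interpret S: deductive_system S by fact
  interpret T: deductive_system T by fact
  have *: "(f (\<Squnion>\<^bsub>theory_lattice S\<^esub>\<A>) = \<Squnion>\<^bsub>theory_lattice T\<^esub>(f ` \<A>)) =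
      (f (cl S (\<Union>\<A>)) = cl T (\<Union>(f ` \<A>)))"
    if "f \<in> carrier (theory_lattice S) \<rightarrow> carrier (theory_lattice T)"
      "\<A> \<subseteq> carrier (theory_lattice S)" for \<A>
  proof -
    have "f ` \<A> \<subseteq> carrier (theory_lattice T)"
      using that by blast
    then show ?thesis
      using that by (simp add: S.sup_theory_lattice T.sup_theory_lattice)
  qed
  show ?thesis
    unfolding sup_lattice_hom_def sup_pres_def
    using * S.complete_lattice_theory_lattice T.complete_lattice_theory_lattice by auto
qed

lemma sup_lattice_hom_of_interpretation:
  assumes "deductive_system S" "deductive_system T"
    and res: "residuated (sdom S) (sdom T) \<iota>"
    and ent: "\<forall>\<Phi> \<subseteq> sdom S. \<forall>\<Psi> \<subseteq> sdom S. \<Phi> \<turnstile>\<^bsub>S\<^esub> \<Psi> \<longleftrightarrow> \<iota> \<Phi> \<turnstile>\<^bsub>T\<^esub> \<iota> \<Psi>"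
  shows "sup_lattice_hom (theory_lattice S) (theory_lattice T) (\<lambda>X. cl T (\<iota> X))"
    and "inj_on (\<lambda>X. cl T (\<iota> X)) (carrier (theory_lattice S))"
proof -
  interpret S: deductive_system S by fact
  interpret T: deductive_system T by fact
  have \<iota>: "\<iota> \<Phi> \<subseteq> sdom T" if "\<Phi> \<subseteq> sdom S" for \<Phi>
    using res that by (auto simp: residuated_def)
  \<comment> \<open>The heart of this direction: the implication to the right gives compatibility
    with closure, the one to the left gives injectivity.\<close>
  have emb: "cl S \<Psi> \<subseteq> cl S \<Phi> \<longleftrightarrow> cl T (\<iota> \<Psi>) \<subseteq> cl T (\<iota> \<Phi>)"
    if "\<Phi> \<subseteq> sdom S" "\<Psi> \<subseteq> sdom S" for \<Phi> \<Psi>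
    using that ent by (simp flip: S.entails_iff_cl_subset T.entails_iff_cl_subset add: \<iota>)
  have "cl T (\<iota> (cl S (\<Union>\<A>))) = cl T (\<Union>((\<lambda>X. cl T (\<iota> X)) ` \<A>))"
    if "\<A> \<subseteq> carrier (theory_lattice S)" for \<A>
  proof -
    have \<A>: "\<A> \<subseteq> Pow (sdom S)"
      using that S.theory_subset_sdom by blast
    then have U: "\<Union>\<A> \<subseteq> sdom S"
      by blast
    \<comment> \<open>\<open>\<Union>\<A>\<close> and its closure generate the same theory of
      \<open>S\<close>, so by \<open>emb\<close>, used both ways, their images generate the same
      theory of \<open>T\<close>.\<close>
    have "cl T (\<iota> (cl S (\<Union>\<A>))) = cl T (\<iota> (\<Union>\<A>))"
      using emb[OF U S.cl_subset_sdom] emb[OF S.cl_subset_sdom U] S.cl_idem[OF U] by blast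
    also have "\<iota> (\<Union>\<A>) = \<Union>(\<iota> ` \<A>)"
      using res \<A> by (simp add: residuated_def)
    also have "cl T (\<Union>(\<iota> ` \<A>)) = cl T (\<Union>((\<lambda>X. cl T (\<iota> X)) ` \<A>))"
      using \<A> by (intro T.cl_UN_cl[symmetric] \<iota>) blast
    finally show ?thesis .
  qed
  moreover have "(\<lambda>X. cl T (\<iota> X)) \<in> carrier (theory_lattice S) \<rightarrow> carrier (theory_lattice T)"
    using \<iota> S.theory_subset_sdom by (simp add: carrier_theory_lattice[of T])
  ultimately show "sup_lattice_hom (theory_lattice S) (theory_lattice T) (\<lambda>X. cl T (\<iota> X))"
    by (simp add: sup_lattice_hom_theory_lattice_iff[OF assms(1,2)])
  show "inj_on (\<lambda>X. cl T (\<iota> X)) (carrier (theory_lattice S))"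
  proof (rule inj_onI)
    fix X Y
    assume XY: "X \<in> carrier (theory_lattice S)" "Y \<in> carrier (theory_lattice S)"
      and eq: "cl T (\<iota> X) = cl T (\<iota> Y)"
    have "cl S X = cl S Y"
      using emb[of X Y] emb[of Y X] XY[THEN S.theory_subset_sdom] eq by blast
    then show "X = Y"
      using XY by (simp add: S.cl_theory)
  qed
qed

text \<open>Order is expressible by joins: \<open>X\<close> lies below \<open>Y\<close> exactly when
  their join is \<open>Y\<close>. An injective join-preserving map both preserves and reflects this
  equation.\<close>

lemma sup_lattice_hom_theory_embedding:
  assumes "deductive_system S" "deductive_system T"
    and hom: "sup_lattice_hom (theory_lattice S) (theory_lattice T) f"
    and inj: "inj_on f (carrier (theory_lattice S))"
    and XY: "X \<in> carrier (theory_lattice S)" "Y \<in> carrier (theory_lattice S)"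
  shows "f X \<subseteq> f Y \<longleftrightarrow> X \<subseteq> Y"
proof -
  interpret S: deductive_system S by fact
  interpret T: deductive_system T by fact
  have car: "f Z \<in> carrier (theory_lattice T)" if "Z \<in> carrier (theory_lattice S)" for Z
    using hom that by (auto simp: sup_lattice_hom_theory_lattice_iff[OF assms(1,2)])
  have sub: "X \<union> Y \<subseteq> sdom S" "f X \<union> f Y \<subseteq> sdom T"
    using XY car S.theory_subset_sdom T.theory_subset_sdom by auto
  have join: "f (cl S (X \<union> Y)) = cl T (f X \<union> f Y)"
    using hom XY
    by (auto simp: sup_lattice_hom_theory_lattice_iff[OF assms(1,2)] dest!: spec[of _ "{X, Y}"])
  have "f X \<subseteq> f Y \<longleftrightarrow> cl T (f X \<union> f Y) = f Y"
    using T.cl_extensive[OF sub(2)] T.cl_theory[OF car[OF XY(2)]] by (auto simp: Un_absorb1)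
  \<comment> \<open>By \<open>join\<close> the left side reads
    \<open>f (cl S (X \<union> Y)) = f Y\<close>, and injectivity cancels \<open>f\<close>.\<close>
  also have "\<dots> \<longleftrightarrow> cl S (X \<union> Y) = Y"
    using inj sub(1) XY(2) by (auto simp flip: join simp: carrier_theory_lattice dest: inj_onD)
  also have "\<dots> \<longleftrightarrow> X \<subseteq> Y"
    using S.cl_extensive[OF sub(1)] S.cl_theory[OF XY(2)] by (auto simp: Un_absorb1)
  finally show ?thesis .
qed

lemma interpretation_of_sup_lattice_hom:
  assumes "deductive_system S" "deductive_system T"
    and hom: "sup_lattice_hom (theory_lattice S) (theory_lattice T) f"
    and inj: "inj_on f (carrier (theory_lattice S))"
  shows "nonstructurally_interpretable S T"
proof -
  interpret S: deductive_system S by fact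
  interpret T: deductive_system T by fact
  \<comment> \<open>The more direct choice \<open>f (cl S \<Phi>)\<close> need not preserve unions:
    it sends the empty set to \<open>cl T {}\<close>, which may be nonempty.\<close>
  define \<iota> where "\<iota> \<Phi> = (\<Union>x\<in>\<Phi>. f (cl S {x}))" for \<Phi>
  have car: "f Z \<in> carrier (theory_lattice T)" if "Z \<in> carrier (theory_lattice S)" for Z
    using hom that by (auto simp: sup_lattice_hom_theory_lattice_iff[OF assms(1,2)])
  have cl_car: "cl S \<Phi> \<in> carrier (theory_lattice S)" if "\<Phi> \<subseteq> sdom S" for \<Phi>
    using that by (simp add: carrier_theory_lattice)
  have \<iota>_sub: "\<iota> \<Phi> \<subseteq> sdom T" if "\<Phi> \<subseteq> sdom S" for \<Phi>
    unfolding \<iota>_def using that by (intro UN_least T.theory_subset_sdom car cl_car) auto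
  have \<iota>_cl: "cl T (\<iota> \<Phi>) = f (cl S \<Phi>)" if "\<Phi> \<subseteq> sdom S" for \<Phi>
  proof -
    have "(\<lambda>x. cl S {x}) ` \<Phi> \<subseteq> carrier (theory_lattice S)"
      using that cl_car by auto
    \<comment> \<open>Join preservation, applied to the family of theories generated by single
      elements of \<open>\<Phi>\<close>.\<close>
    then have "cl T (\<iota> \<Phi>) = f (cl S (\<Union>x\<in>\<Phi>. cl S {x}))"
      using hom by (simp add: sup_lattice_hom_theory_lattice_iff[OF assms(1,2)] \<iota>_def image_image)
    also have "cl S (\<Union>x\<in>\<Phi>. cl S {x}) = cl S \<Phi>"
      using S.cl_UN_cl[of \<Phi> "\<lambda>x. {x}"] that by auto
    finally show ?thesis .
  qed
  have "residuated (sdom S) (sdom T) \<iota>"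
    using \<iota>_sub by (auto simp: residuated_def \<iota>_def)
  \<comment> \<open>Both entailments become inclusions of theories; \<open>\<iota>_cl\<close> writes
    those on the \<open>T\<close> side as values of \<open>f\<close>, which is an order
    embedding.\<close>
  moreover have "\<Phi> \<turnstile>\<^bsub>S\<^esub> \<Psi> \<longleftrightarrow> \<iota> \<Phi> \<turnstile>\<^bsub>T\<^esub> \<iota> \<Psi>" if "\<Phi> \<subseteq> sdom S" "\<Psi> \<subseteq> sdom S" for \<Phi> \<Psi>
    using that
    by (simp add: S.entails_iff_cl_subset T.entails_iff_cl_subset \<iota>_sub \<iota>_cl cl_car
        sup_lattice_hom_theory_embedding[OF assms])
  ultimately show ?thesis
    unfolding nonstructurally_interpretable_def by blast
qed

theorem theorem5p6p3:
  fixes S :: "'c dsystem" and T :: "'d dsystem"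
  assumes "deductive_system S" and "deductive_system T"
    and "\<not> (\<forall>\<Phi> \<subseteq> sdom S. cl S \<Phi> = \<Phi>)"
    and "\<not> (\<forall>\<Phi> \<subseteq> sdom T. cl T \<Phi> = \<Phi>)"
  shows "nonstructurally_interpretable S T \<longleftrightarrow>
    (\<exists>f. sup_lattice_hom (theory_lattice S) (theory_lattice T) f \<and>
         inj_on f (carrier (theory_lattice S)))"
proof
  assume "nonstructurally_interpretable S T"
  then show "\<exists>f. sup_lattice_hom (theory_lattice S) (theory_lattice T) f \<and>
      inj_on f (carrier (theory_lattice S))"
    using sup_lattice_hom_of_interpretation[OF assms(1,2)]
    unfolding nonstructurally_interpretable_def by blast
next
  assume "\<exists>f. sup_lattice_hom (theory_lattice S) (theory_lattice T) f \<and>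
      inj_on f (carrier (theory_lattice S))"
  then show "nonstructurally_interpretable S T"
    using interpretation_of_sup_lattice_hom[OF assms(1,2)] by blast
qed

end
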